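(* Let $\lambda_1,\lambda_2>0$, $\lambda=\max\{\lambda_1,\lambda_2\}$, and let $(u,v)$ be a blow-up solution, with (finite) blow-up time $T$, of the problem $$u_t=\Delta u+\lambda_1e^{v},\quad v_t=\Delta v+\lambda_2 e^{u}\quad\text{in } B_R\times(0,T),$$ $$\frac{\partial u}{\partial \eta}=e^{v},\quad \frac{\partial v}{\partial \eta}=e^{u}\quad\text{on }\partial B_R\times(0,T),$$ $$u(x,0)=u_0(x),\quad v(x,0)=v_0(x),\quad x\in B_R,$$ where the initial data $u_0,v_0$ satisfy the standing assumptions listed in the context. Let $C>0$ be a constant such that $$u(R,t)\le \log C-\log(T-t),\qquad v(R,t)\le \log C-\log(T-t),\qquad t\in(0,T).$$ Assume that $$\lambda\,[4R^2(n+1)+1]\le \min\left\{\frac1C,\ \frac{4(n+1)}{R^2+4(n+1)T}\,e^{-\|u_0\|_\infty},\ \frac{4(n+1)}{R^2+4(n+1)T}\,e^{-\|v_0\|_\infty}\right\}.$$ Then there exists a positive constant $A$ such that $$u(x,t)\le \log\left[\frac{1}{A(R^2-r^2)^2}\right],\qquad v(x,t)\le \log\left[\frac{1}{A(R^2-r^2)^2}\right],\qquad r=|x|,$$ for all $(x,t)\in B_R\times(0,T)$.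
   Context: $B_R\subset\mathbb{R}^n$ is the open ball of radius $R>0$ centered at the origin ($n$ is the space dimension), $\partial B_R$ its boundary, $\eta$ the outward unit normal on $\partial B_R$, and $\|\cdot\|_\infty$ is the sup norm on $B_R$. Solutions are classical; they are radial in $x$, and one writes $r=|x|$, $u(r,t)=u(x,t)$, with the subscript $r$ denoting the radial derivative. A blow-up solution with blow-up time $T<\infty$ is a classical solution whose maximal existence interval is $[0,T)$ and which becomes unbounded (in sup norm over $B_R$) as $t\to T^-$. Standing assumptions on the initial data: $u_0,v_0$ are nonnegative, radial, radially nondecreasing, smooth functions on $\overline{B}_R$ satisfying (a) $\frac{\partial u_0}{\partial\eta}=e^{v_0}$ and $\frac{\partial v_0}{\partial\eta}=e^{u_0}$ on $\partial B_R$; (b) $\Delta u_0+e^{v_0}\ge 0$ and $\Delta v_0+e^{u_0}\ge 0$ on $\overline{B}_R$; (c) $u_{0r}(|x|)\ge 0$ and $v_{0r}(|x|)\ge 0$ for $x\in\overline{B}_R$. *)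

theory Defs
  imports "HOL-Analysis.Analysis"
begin

text \<open>
  Derivatives are taken relative to a set \<open>S\<close>, so that they also make sense at boundary
  points of the closed ball. For \<open>S = ball 0 R\<close> and \<open>S = cball 0 R\<close> with \<open>R > 0\<close> the derivative
  is unique where it exists, and at interior points it is the usual one.
\<close>

definition dir_deriv :: "'a::euclidean_space set \<Rightarrow> 'a \<Rightarrow> ('a \<Rightarrow> real) \<Rightarrow> 'a \<Rightarrow> real" where
  "dir_deriv S e f x = frechet_derivative f (at x within S) e"

definition laplacian :: "'a::euclidean_space set \<Rightarrow> ('a \<Rightarrow> real) \<Rightarrow> 'a \<Rightarrow> real" where
  "laplacian S f x = (\<Sum>b\<in>Basis. dir_deriv S b (dir_deriv S b f) x)"

text \<open>
  On the sphere of radius \<open>R\<close>, \<open>sgn x = x /\<^sub>R norm x\<close> is the outward unit normal, so there this is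
  the normal derivative. At the origin \<open>sgn 0 = 0\<close> gives the value 0, which is the radial
  derivative at 0 of any differentiable radial function.
\<close>

definition radial_deriv :: "real \<Rightarrow> ('a::euclidean_space \<Rightarrow> real) \<Rightarrow> 'a \<Rightarrow> real" where
  "radial_deriv R f x = dir_deriv (cball 0 R) (sgn x) f x"

primrec Ck_on :: "nat \<Rightarrow> 'a::euclidean_space set \<Rightarrow> ('a \<Rightarrow> real) \<Rightarrow> bool" where
  "Ck_on 0 S f \<longleftrightarrow> continuous_on S f"
| "Ck_on (Suc k) S f \<longleftrightarrow>
     (\<forall>x\<in>S. f differentiable (at x within S)) \<and> (\<forall>b\<in>Basis. Ck_on k S (dir_deriv S b f))"

definition smooth_on :: "'a::euclidean_space set \<Rightarrow> ('a \<Rightarrow> real) \<Rightarrow> bool" where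
  "smooth_on S f \<longleftrightarrow> (\<forall>k. Ck_on k S f)"

definition radial_on :: "'a::euclidean_space set \<Rightarrow> ('a \<Rightarrow> real) \<Rightarrow> bool" where
  "radial_on S f \<longleftrightarrow> (\<forall>x\<in>S. \<forall>y\<in>S. norm x = norm y \<longrightarrow> f x = f y)"

definition radially_nondecreasing_on :: "'a::euclidean_space set \<Rightarrow> ('a \<Rightarrow> real) \<Rightarrow> bool" where
  "radially_nondecreasing_on S f \<longleftrightarrow> (\<forall>x\<in>S. \<forall>y\<in>S. norm x \<le> norm y \<longrightarrow> f x \<le> f y)"

definition sup_norm :: "'a::euclidean_space set \<Rightarrow> ('a \<Rightarrow> real) \<Rightarrow> real" where
  "sup_norm S f = (SUP x\<in>S. \<bar>f x\<bar>)"

definition admissible_data ::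
  "real \<Rightarrow> ('a::euclidean_space \<Rightarrow> real) \<Rightarrow> ('a \<Rightarrow> real) \<Rightarrow> bool" where
  "admissible_data R u0 v0 \<longleftrightarrow>
     smooth_on (cball 0 R) u0 \<and> smooth_on (cball 0 R) v0 \<and>
     (\<forall>x\<in>cball 0 R. 0 \<le> u0 x \<and> 0 \<le> v0 x) \<and>
     radial_on (cball 0 R) u0 \<and> radial_on (cball 0 R) v0 \<and>
     radially_nondecreasing_on (cball 0 R) u0 \<and> radially_nondecreasing_on (cball 0 R) v0 \<and>
     (\<forall>x\<in>sphere 0 R. radial_deriv R u0 x = exp (v0 x) \<and> radial_deriv R v0 x = exp (u0 x)) \<and>
     (\<forall>x\<in>cball 0 R. 0 \<le> laplacian (cball 0 R) u0 x + exp (v0 x) \<and>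
                    0 \<le> laplacian (cball 0 R) v0 x + exp (u0 x)) \<and>
     (\<forall>x\<in>cball 0 R. 0 \<le> radial_deriv R u0 x \<and> 0 \<le> radial_deriv R v0 x)"

text \<open>
  The regularity of a classical solution of a parabolic Neumann problem: continuous on
  \<open>cball 0 R \<times> [0,T)\<close>, with continuous spatial gradient on \<open>cball 0 R \<times> (0,T)\<close>, and of class
  \<open>C\<^sup>2\<close> in space and \<open>C\<^sup>1\<close> in time on \<open>ball 0 R \<times> (0,T)\<close>.
\<close>

definition classical_regularity ::
  "real \<Rightarrow> real \<Rightarrow> ('a::euclidean_space \<Rightarrow> real \<Rightarrow> real) \<Rightarrow> bool" where
  "classical_regularity R T u \<longleftrightarrow>
     continuous_on (cball 0 R \<times> {0..<T}) (\<lambda>(x, t). u x t) \<and>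
     (\<forall>t\<in>{0<..<T}. \<forall>x\<in>cball 0 R. (\<lambda>y. u y t) differentiable (at x within cball 0 R)) \<and>
     (\<forall>b\<in>Basis. continuous_on (cball 0 R \<times> {0<..<T})
        (\<lambda>(x, t). dir_deriv (cball 0 R) b (\<lambda>y. u y t) x)) \<and>
     (\<forall>t\<in>{0<..<T}. Ck_on 2 (ball 0 R) (\<lambda>y. u y t)) \<and>
     (\<forall>b\<in>Basis. \<forall>c\<in>Basis. continuous_on (ball 0 R \<times> {0<..<T})
        (\<lambda>(x, t). dir_deriv (ball 0 R) c (dir_deriv (ball 0 R) b (\<lambda>y. u y t)) x)) \<and>
     (\<forall>x\<in>ball 0 R. \<forall>t\<in>{0<..<T}. u x differentiable (at t)) \<and>
     continuous_on (ball 0 R \<times> {0<..<T}) (\<lambda>(x, t). deriv (u x) t)"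

definition classical_solution ::
  "real \<Rightarrow> real \<Rightarrow> real \<Rightarrow> ('a::euclidean_space \<Rightarrow> real) \<Rightarrow> ('a \<Rightarrow> real) \<Rightarrow>
   real \<Rightarrow> ('a \<Rightarrow> real \<Rightarrow> real) \<Rightarrow> ('a \<Rightarrow> real \<Rightarrow> real) \<Rightarrow> bool" where
  "classical_solution l1 l2 R u0 v0 T u v \<longleftrightarrow>
     classical_regularity R T u \<and> classical_regularity R T v \<and>
     (\<forall>t\<in>{0..<T}. radial_on (cball 0 R) (\<lambda>x. u x t) \<and> radial_on (cball 0 R) (\<lambda>x. v x t)) \<and>
     (\<forall>x\<in>ball 0 R. \<forall>t\<in>{0<..<T}.
        deriv (u x) t = laplacian (ball 0 R) (\<lambda>y. u y t) x + l1 * exp (v x t) \<and>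
        deriv (v x) t = laplacian (ball 0 R) (\<lambda>y. v y t) x + l2 * exp (u x t)) \<and>
     (\<forall>x\<in>sphere 0 R. \<forall>t\<in>{0<..<T}.
        radial_deriv R (\<lambda>y. u y t) x = exp (v x t) \<and>
        radial_deriv R (\<lambda>y. v y t) x = exp (u x t)) \<and>
     (\<forall>x\<in>ball 0 R. u x 0 = u0 x \<and> v x 0 = v0 x)"

definition blow_up_solution ::
  "real \<Rightarrow> real \<Rightarrow> real \<Rightarrow> ('a::euclidean_space \<Rightarrow> real) \<Rightarrow> ('a \<Rightarrow> real) \<Rightarrow>
   real \<Rightarrow> ('a \<Rightarrow> real \<Rightarrow> real) \<Rightarrow> ('a \<Rightarrow> real \<Rightarrow> real) \<Rightarrow> bool" where
  "blow_up_solution l1 l2 R u0 v0 T u v \<longleftrightarrow>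
     0 < T \<and>
     classical_solution l1 l2 R u0 v0 T u v \<and>
     \<not> (\<exists>T' u' v'. T < T' \<and> classical_solution l1 l2 R u0 v0 T' u' v' \<and>
          (\<forall>x\<in>cball 0 R. \<forall>t\<in>{0..<T}. u' x t = u x t \<and> v' x t = v x t)) \<and>
     (\<forall>M. \<exists>\<^sub>F t in at_left T.
        M < max (sup_norm (ball 0 R) (\<lambda>x. u x t)) (sup_norm (ball 0 R) (\<lambda>x. v x t)))"

end

theory Submission
  imports Defs
begin

text \<open>
  Write \<open>n\<close> for the dimension, \<open>\<lambda> = max \<lambda>\<^sub>1 \<lambda>\<^sub>2\<close>, \<open>B = 4R\<^sup>2(n + 1) + 1\<close>, and consider the barrier
  \<open>w(x,t) = - ln (\<lambda>((R\<^sup>2 - r\<^sup>2)\<^sup>2 + B(S - t)))\<close> for an arbitrary \<open>S < T\<close>. With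
  \<open>z = (R\<^sup>2 - r\<^sup>2)\<^sup>2 + B(S - t)\<close> one has \<open>w\<^sub>t = B/z\<close>, \<open>\<lambda> e\<^sup>w = 1/z\<close> and
  \<open>\<Delta>w = (4n(R\<^sup>2 - r\<^sup>2) - 8r\<^sup>2 + 16r\<^sup>2(R\<^sup>2 - r\<^sup>2)\<^sup>2/z)/z\<close>. Since \<open>(R\<^sup>2 - r\<^sup>2)\<^sup>2 \<le> z\<close>, the numerator of
  \<open>\<Delta>w\<close> is at most \<open>4n(R\<^sup>2 - r\<^sup>2) + 8r\<^sup>2 < 4(n + 1)R\<^sup>2\<close> in the open ball, so that
  \<open>w\<^sub>t > \<Delta>w + \<lambda>e\<^sup>w\<close> strictly.

  The hypothesis on \<open>\<lambda>\<close> places \<open>u\<close> and \<open>v\<close> below \<open>w\<close> on the parabolic boundary: the bound by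
  \<open>1/C\<close> makes the assumed rate \<open>ln C - ln (T - t)\<close> at most \<open>- ln (\<lambda>B(T - t))\<close>, which is the value of
  the barrier on the sphere for \<open>S = T\<close>, and the other two bounds give the same at time \<open>0\<close>.
  Replacing \<open>T\<close> by \<open>S < T\<close> makes both comparisons strict.

  Hence \<open>u < w\<close> and \<open>v < w\<close> for all \<open>t < S\<close>. Otherwise there is a first time \<open>t\<close> at which one of
  them, say \<open>u\<close>, touches \<open>w\<close>, necessarily at an interior point \<open>x\<close>. There \<open>u\<^sub>t \<ge> w\<^sub>t\<close>,
  \<open>\<Delta>u \<le> \<Delta>w\<close> and \<open>v \<le> w\<close>, so \<open>u\<^sub>t = \<Delta>u + \<lambda>\<^sub>1e\<^sup>v \<le> \<Delta>w + \<lambda>e\<^sup>w < w\<^sub>t\<close>, which is absurd. Both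
  components can be compared with the same \<open>w\<close> because each reaction term increases with the other
  component.
  For a given \<open>t < T\<close>, choosing \<open>S\<close> between \<open>t\<close> and \<open>T\<close> and dropping the term \<open>B(S - t)\<close> gives the
  claim with \<open>A = \<lambda>\<close>.
\<close>

section \<open>The second derivative test along coordinate lines\<close>

lemma second_derivative_nonpos_at_max:
  fixes g g' :: "real \<Rightarrow> real"
  assumes "0 < e"
    and g: "\<And>s. \<bar>s\<bar> < e \<Longrightarrow> (g has_real_derivative g' s) (at s)"
    and g': "(g' has_real_derivative D) (at 0)"
    and max: "\<And>s. \<bar>s\<bar> < e \<Longrightarrow> g s \<le> g 0"
  shows "D \<le> 0"
proof (rule ccontr)
  assume "\<not> D \<le> 0"
  then have "0 < D" by simp
  have "g' 0 = 0"
    using DERIV_local_max[of g "g' 0" 0 e] g[of 0] max \<open>0 < e\<close> by (auto simp: abs_minus_commute)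
  obtain d where d: "0 < d" "\<And>h. 0 < h \<Longrightarrow> h < d \<Longrightarrow> g' 0 < g' (0 + h)"
    using DERIV_pos_inc_right[OF g' \<open>0 < D\<close>] by blast
  define h where "h = min d e / 2"
  have h: "0 < h" "h < d" "h < e"
    using d(1) \<open>0 < e\<close> by (auto simp: h_def min_def)
  obtain z where z: "0 < z" "z < h" "g h - g 0 = (h - 0) * g' z"
    using MVT2[of 0 h g g'] h g by auto
  have "0 < g' z"
    using d(2)[of z] z h \<open>g' 0 = 0\<close> by simp
  then have "0 < g h - g 0"
    unfolding z(3) using h by simp
  with max[of h] h show False by simp
qed

lemma has_real_derivative_along_line:
  fixes f :: "'a::euclidean_space \<Rightarrow> real"
  assumes "open S" and "x + s *\<^sub>R b \<in> S"
    and "f differentiable (at (x + s *\<^sub>R b) within S)"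
  shows "((\<lambda>s. f (x + s *\<^sub>R b)) has_real_derivative dir_deriv S b f (x + s *\<^sub>R b)) (at s)"
proof -
  let ?F = "frechet_derivative f (at (x + s *\<^sub>R b) within S)"
  have F: "(f has_derivative ?F) (at (x + s *\<^sub>R b))"
    using assms by (metis at_within_open frechet_derivative_works)
  have line: "((\<lambda>s. x + s *\<^sub>R b) has_derivative (\<lambda>h. h *\<^sub>R b)) (at s)"
    by (auto intro!: derivative_eq_intros)
  have "((\<lambda>s. f (x + s *\<^sub>R b)) has_derivative (\<lambda>h. ?F (h *\<^sub>R b))) (at s)"
    using has_derivative_compose[OF line F] .
  moreover have "?F (h *\<^sub>R b) = dir_deriv S b f (x + s *\<^sub>R b) * h" for h
    using linear_cmul[OF has_derivative_linear[OF F], of h b] by (simp add: dir_deriv_def)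
  ultimately show ?thesis
    by (simp add: has_field_derivative_def)
qed

text \<open>
  If \<open>f - W\<close> has a maximum at \<open>x\<close>, then so has its restriction to each coordinate line through \<open>x\<close>.
  The comparison function \<open>W\<close> is given through these restrictions, so that for an explicit \<open>W\<close> only
  one-variable derivatives have to be computed.
\<close>

lemma laplacian_le_at_touching_point:
  fixes f :: "'a::euclidean_space \<Rightarrow> real"
  assumes "open S" and "x \<in> S" and f: "Ck_on 2 S f"
    and W: "\<And>b s. b \<in> Basis \<Longrightarrow> x + s *\<^sub>R b \<in> S \<Longrightarrow>
      ((\<lambda>s. W (x + s *\<^sub>R b)) has_real_derivative W' b s) (at s)"
    and W': "\<And>b. b \<in> Basis \<Longrightarrow> (W' b has_real_derivative W'' b) (at 0)"
    and max: "\<And>y. y \<in> S \<Longrightarrow> f y - W y \<le> f x - W x"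
  shows "laplacian S f x \<le> (\<Sum>b\<in>Basis. W'' b)"
  unfolding laplacian_def
proof (rule sum_mono)
  fix b :: 'a
  assume b: "b \<in> Basis"
  have f1: "f differentiable (at y within S)" if "y \<in> S" for y
    using f that by (simp add: numeral_2_eq_2)
  have f2: "dir_deriv S b f differentiable (at y within S)" if "y \<in> S" for y
    using f b that by (simp add: numeral_2_eq_2)
  obtain e where e: "0 < e" "ball x e \<subseteq> S"
    using \<open>open S\<close> \<open>x \<in> S\<close> openE by blast
  have inS: "x + s *\<^sub>R b \<in> S" if "\<bar>s\<bar> < e" for s
    using that b e(2) by (auto simp: dist_norm)
  have "dir_deriv S b (dir_deriv S b f) x - W'' b \<le> 0"
  proof (rule second_derivative_nonpos_at_max[OF e(1)])
    fix s :: real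
    assume s: "\<bar>s\<bar> < e"
    show "((\<lambda>s. f (x + s *\<^sub>R b) - W (x + s *\<^sub>R b)) has_real_derivative
        dir_deriv S b f (x + s *\<^sub>R b) - W' b s) (at s)"
      by (intro DERIV_diff has_real_derivative_along_line W f1 b inS s \<open>open S\<close>)
    show "f (x + s *\<^sub>R b) - W (x + s *\<^sub>R b) \<le> f (x + 0 *\<^sub>R b) - W (x + 0 *\<^sub>R b)"
      using max[OF inS[OF s]] by simp
  next
    have "((\<lambda>s. dir_deriv S b f (x + s *\<^sub>R b)) has_real_derivative
        dir_deriv S b (dir_deriv S b f) (x + 0 *\<^sub>R b)) (at 0)"
      by (rule has_real_derivative_along_line) (use \<open>open S\<close> \<open>x \<in> S\<close> f2 in auto)
    then show "((\<lambda>s. dir_deriv S b f (x + s *\<^sub>R b) - W' b s) has_real_derivative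
        dir_deriv S b (dir_deriv S b f) x - W'' b) (at 0)"
      using W'[OF b] by (intro DERIV_diff) auto
  qed
  then show "dir_deriv S b (dir_deriv S b f) x \<le> W'' b" by simp
qed

section \<open>The barrier\<close>

definition barrier :: "real \<Rightarrow> real \<Rightarrow> real \<Rightarrow> real \<Rightarrow> 'a::euclidean_space \<Rightarrow> real \<Rightarrow> real" where
  "barrier A B R S x t = - ln (A * ((R\<^sup>2 - (norm x)\<^sup>2)\<^sup>2 + B * (S - t)))"

lemma barrier_argument_pos:
  fixes B :: real
  assumes "0 < B" and "t < S"
  shows "0 < (R\<^sup>2 - (norm x)\<^sup>2)\<^sup>2 + B * (S - t)"
  using assms by (simp add: add_nonneg_pos)

lemma exp_barrier:
  assumes "0 < A" and "0 < B" and "t < S"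
  shows "exp (barrier A B R S x t) = 1 / (A * ((R\<^sup>2 - (norm x)\<^sup>2)\<^sup>2 + B * (S - t)))"
  using assms barrier_argument_pos[OF assms(2,3), of R x]
  by (simp add: barrier_def exp_minus inverse_eq_divide)

lemma continuous_on_barrier:
  assumes "0 < A" and "0 < B" and "t1 < S"
  shows "continuous_on (K \<times> {0..t1}) (\<lambda>(x, t). barrier A B R S x t)"
proof -
  have "A * ((R\<^sup>2 - (norm x)\<^sup>2)\<^sup>2 + B * (S - t)) \<noteq> 0" if "t \<le> t1" for x :: 'a and t
    using barrier_argument_pos[of B t S R x] assms that by simp
  then show ?thesis
    unfolding barrier_def case_prod_unfold by (auto intro!: continuous_intros)
qed

lemma barrier_time_derivative:
  assumes "0 < A" and "0 < B" and "t < S"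
  shows "(barrier A B R S x has_real_derivative
    B / ((R\<^sup>2 - (norm x)\<^sup>2)\<^sup>2 + B * (S - t))) (at t)"
proof -
  have z: "0 < (R\<^sup>2 - (norm x)\<^sup>2)\<^sup>2 + B * (S - t)"
    using assms barrier_argument_pos by blast
  have "((\<lambda>t. A * ((R\<^sup>2 - (norm x)\<^sup>2)\<^sup>2 + B * (S - t))) has_real_derivative - (A * B)) (at t)"
    by (rule derivative_eq_intros refl | simp)+
  then have "((\<lambda>t. - ln (A * ((R\<^sup>2 - (norm x)\<^sup>2)\<^sup>2 + B * (S - t)))) has_real_derivative
      - (1 / (A * ((R\<^sup>2 - (norm x)\<^sup>2)\<^sup>2 + B * (S - t))) * (- (A * B)))) (at t)"
    using z \<open>0 < A\<close> by (intro DERIV_minus DERIV_chain2[OF DERIV_ln_divide]) auto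
  moreover have "barrier A B R S x = (\<lambda>t. - ln (A * ((R\<^sup>2 - (norm x)\<^sup>2)\<^sup>2 + B * (S - t))))"
    by (simp add: barrier_def fun_eq_iff)
  ultimately show ?thesis
    using \<open>0 < A\<close> by simp
qed

text \<open>
  On a coordinate line through \<open>x\<close> the quantity \<open>R\<^sup>2 - (norm x)\<^sup>2\<close> becomes the polynomial
  \<open>R\<^sup>2 - (norm x)\<^sup>2 - 2 * s * (x \<bullet> b) - s\<^sup>2\<close>, which makes both derivatives below elementary.
\<close>

lemma norm_along_line:
  fixes x b :: "'a::euclidean_space"
  assumes "b \<in> Basis"
  shows "(norm (x + s *\<^sub>R b))\<^sup>2 = (norm x)\<^sup>2 + 2 * s * (x \<bullet> b) + s\<^sup>2"
  unfolding power2_norm_eq_inner using assms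
  by (simp add: inner_add_left inner_add_right inner_commute[of b x] power2_eq_square
    algebra_simps)

lemma barrier_derivative_along_line:
  fixes x b :: "'a::euclidean_space" and R :: real
  assumes "0 < A" and "0 < B" and "t < S" and b: "b \<in> Basis"
  defines "p \<equiv> \<lambda>s. R\<^sup>2 - (norm (x + s *\<^sub>R b))\<^sup>2"
  shows "((\<lambda>s. barrier A B R S (x + s *\<^sub>R b) t) has_real_derivative
    4 * p s * (x \<bullet> b + s) / ((p s)\<^sup>2 + B * (S - t))) (at s)"
proof -
  have z: "0 < (p s)\<^sup>2 + B * (S - t)"
    unfolding p_def using assms(2,3) barrier_argument_pos by blast
  have p': "(p has_real_derivative (- 2 * (x \<bullet> b + s))) (at s)"
    unfolding p_def norm_along_line[OF b]
    by (auto intro!: derivative_eq_intros simp: algebra_simps)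
  have "((\<lambda>s. A * ((p s)\<^sup>2 + B * (S - t))) has_real_derivative
      A * (2 * p s * (- 2 * (x \<bullet> b + s)))) (at s)"
    by (rule derivative_eq_intros p' refl | simp)+
  then have "((\<lambda>s. - ln (A * ((p s)\<^sup>2 + B * (S - t)))) has_real_derivative
      - (1 / (A * ((p s)\<^sup>2 + B * (S - t))) * (A * (2 * p s * (- 2 * (x \<bullet> b + s)))))) (at s)"
    using z \<open>0 < A\<close> by (intro DERIV_minus DERIV_chain2[OF DERIV_ln_divide]) auto
  moreover have "- (1 / (A * Z) * (A * (2 * P * (- 2 * y)))) = 4 * P * y / Z" for P y Z :: real
    using \<open>0 < A\<close> by simp
  ultimately show ?thesis
    by (simp only: barrier_def p_def)
qed

lemma barrier_second_derivative_along_line: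
  fixes x b :: "'a::euclidean_space" and R :: real
  assumes "0 < B" and "t < S" and b: "b \<in> Basis"
  defines "p \<equiv> \<lambda>s. R\<^sup>2 - (norm (x + s *\<^sub>R b))\<^sup>2"
  defines "q \<equiv> R\<^sup>2 - (norm x)\<^sup>2"
  defines "z \<equiv> q\<^sup>2 + B * (S - t)"
  shows "((\<lambda>s. 4 * p s * (x \<bullet> b + s) / ((p s)\<^sup>2 + B * (S - t))) has_real_derivative
    4 * q / z + (16 * q\<^sup>2 / z - 8) / z * (x \<bullet> b)\<^sup>2) (at 0)"
proof -
  have p0: "p 0 = q" by (simp add: p_def q_def)
  have z: "0 < z"
    unfolding z_def q_def using assms(1,2) barrier_argument_pos by blast
  have z0: "(p 0)\<^sup>2 + B * (S - t) = z" by (simp add: p0 z_def)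
  have p': "(p has_real_derivative (- 2 * (x \<bullet> b))) (at 0)"
    unfolding p_def norm_along_line[OF b]
    by (auto intro!: derivative_eq_intros simp: algebra_simps)
  have N: "((\<lambda>s. 4 * p s * (x \<bullet> b + s)) has_real_derivative 4 * q - 8 * (x \<bullet> b)\<^sup>2) (at 0)"
    by (rule derivative_eq_intros p' refl | simp add: p0 power2_eq_square)+
  have D: "((\<lambda>s. (p s)\<^sup>2 + B * (S - t)) has_real_derivative - 4 * q * (x \<bullet> b)) (at 0)"
    by (rule derivative_eq_intros p' refl | simp add: p0)+
  have "((\<lambda>s. 4 * p s * (x \<bullet> b + s) / ((p s)\<^sup>2 + B * (S - t))) has_real_derivative
      ((4 * q - 8 * (x \<bullet> b)\<^sup>2) * z - 4 * q * (x \<bullet> b) * (- 4 * q * (x \<bullet> b))) / (z * z)) (at 0)"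
    using DERIV_divide[OF N D] z z0 by (simp add: p0)
  moreover have "((4 * q - 8 * (x \<bullet> b)\<^sup>2) * z - 4 * q * (x \<bullet> b) * (- 4 * q * (x \<bullet> b))) / (z * z)
      = 4 * q / z + (16 * q\<^sup>2 / z - 8) / z * (x \<bullet> b)\<^sup>2"
    using z by (simp add: field_simps power2_eq_square)
  ultimately show ?thesis by simp
qed

text \<open>
  The barrier is a strict supersolution of \<open>w\<^sub>t = \<Delta>w + A e\<^sup>w\<close>. The statement is formulated directly at a
  point where a function \<open>u\<close> touches the barrier from below for the first time, which is where it
  is used; strictness comes from \<open>norm x < R\<close>.
\<close>

lemma touching_barrier_strict:
  fixes u :: "'a::euclidean_space \<Rightarrow> real \<Rightarrow> real"
  assumes "0 < A" and B: "B = 4 * R\<^sup>2 * (real DIM('a) + 1) + 1"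
    and x: "x \<in> ball 0 R" and "0 < t" and "t < S"
    and C2: "Ck_on 2 (ball 0 R) (\<lambda>y. u y t)"
    and diff: "u x differentiable (at t)"
    and touch: "u x t = barrier A B R S x t"
    and below: "\<And>y. y \<in> ball 0 R \<Longrightarrow> u y t \<le> barrier A B R S y t"
    and before: "\<And>s. 0 \<le> s \<Longrightarrow> s < t \<Longrightarrow> u x s < barrier A B R S x s"
  shows "laplacian (ball 0 R) (\<lambda>y. u y t) x + A * exp (barrier A B R S x t) < deriv (u x) t"
proof -
  define n where "n = real DIM('a)"
  define r2 where "r2 = (norm x)\<^sup>2"
  define q where "q = R\<^sup>2 - r2"
  define z where "z = q\<^sup>2 + B * (S - t)"
  have "0 < B" using B by (simp add: add_nonneg_pos)
  have "1 \<le> n" by (simp add: n_def Suc_leI)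
  have "0 \<le> r2" "r2 < R\<^sup>2"
    using x by (auto simp: r2_def power_strict_mono)
  have z: "0 < z"
    unfolding z_def q_def r2_def using \<open>0 < B\<close> \<open>t < S\<close> barrier_argument_pos by blast
  have "laplacian (ball 0 R) (\<lambda>y. u y t) x \<le>
      (\<Sum>b\<in>Basis. 4 * q / z + (16 * q\<^sup>2 / z - 8) / z * (x \<bullet> b)\<^sup>2)"
  proof (rule laplacian_le_at_touching_point[OF open_ball x C2])
    show "u y t - barrier A B R S y t \<le> u x t - barrier A B R S x t" if "y \<in> ball 0 R" for y
      using below[OF that] touch by simp
  qed (use barrier_derivative_along_line[OF \<open>0 < A\<close> \<open>0 < B\<close> \<open>t < S\<close>, of _ R x]
        barrier_second_derivative_along_line[OF \<open>0 < B\<close> \<open>t < S\<close>, of _ R x]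
       in \<open>auto simp: z_def q_def r2_def\<close>)
  also have "\<dots> = n * (4 * q / z) + (16 * q\<^sup>2 / z - 8) / z * r2"
  proof -
    have "r2 = (\<Sum>b\<in>Basis. (x \<bullet> b)\<^sup>2)"
      unfolding r2_def power2_norm_eq_inner euclidean_inner[of x x] by (simp add: power2_eq_square)
    then show ?thesis
      by (simp only: sum.distrib sum_constant sum_distrib_left n_def)
  qed
  also have "\<dots> = (4 * n * q + (16 * (q\<^sup>2 / z) - 8) * r2) / z"
    using z by (simp add: field_simps)
  finally have lap: "laplacian (ball 0 R) (\<lambda>y. u y t) x \<le>
    (4 * n * q + (16 * (q\<^sup>2 / z) - 8) * r2) / z" .
  have "q\<^sup>2 / z \<le> 1"
    using z \<open>0 < B\<close> \<open>t < S\<close> by (simp add: z_def)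
  then have "(16 * (q\<^sup>2 / z) - 8) * r2 \<le> 8 * r2"
    using \<open>0 \<le> r2\<close> by (intro mult_right_mono) auto
  \<comment> \<open>For \<open>n = 1\<close> the coefficient \<open>8 - 4 * n\<close> of \<open>r2\<close> is positive; it is at most \<open>4\<close> in every dimension.\<close>
  moreover have "r2 \<le> n * r2"
    using \<open>1 \<le> n\<close> \<open>0 \<le> r2\<close> by (simp add: mult_le_cancel_right1)
  ultimately have "4 * n * q + (16 * (q\<^sup>2 / z) - 8) * r2 + 1 < B"
    using \<open>r2 < R\<^sup>2\<close> unfolding B q_def n_def[symmetric] by (simp add: algebra_simps)
  then have "(4 * n * q + (16 * (q\<^sup>2 / z) - 8) * r2) / z + 1 / z < B / z"
    using z by (simp add: add_divide_distrib[symmetric] divide_strict_right_mono)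
  moreover have "A * exp (barrier A B R S x t) = 1 / z"
    using exp_barrier[OF \<open>0 < A\<close> \<open>0 < B\<close> \<open>t < S\<close>, of R x] \<open>0 < A\<close>
    by (simp add: z_def q_def r2_def)
  \<comment> \<open>Otherwise \<open>u - w\<close>, being zero at time \<open>t\<close>, would be positive shortly before \<open>t\<close>.\<close>
  moreover have "B / z \<le> deriv (u x) t"
  proof (rule ccontr)
    assume "\<not> B / z \<le> deriv (u x) t"
    moreover have "((\<lambda>s. u x s - barrier A B R S x s) has_real_derivative deriv (u x) t - B / z) (at t)"
      using barrier_time_derivative[OF \<open>0 < A\<close> \<open>0 < B\<close> \<open>t < S\<close>, of R x] diff
      by (intro DERIV_diff) (auto simp: z_def q_def r2_def DERIV_deriv_iff_real_differentiable)
    ultimately obtain d where d: "0 < d" "\<And>h. 0 < h \<Longrightarrow> h < d \<Longrightarrow>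
        u x t - barrier A B R S x t < u x (t - h) - barrier A B R S x (t - h)"
      using DERIV_neg_dec_left[of "\<lambda>s. u x s - barrier A B R S x s" "deriv (u x) t - B / z" t] by auto
    define h where "h = min d t / 2"
    have "0 < h" "h < d" "h < t"
      using d(1) \<open>0 < t\<close> by (auto simp: h_def min_def)
    with d(2)[of h] before[of "t - h"] touch show False by simp
  qed
  ultimately show ?thesis using lap by linarith
qed

section \<open>Comparison by the first touching time\<close>

text \<open>
  The set where \<open>f\<close> is nonnegative is compact, so it has a point with smallest time coordinate.
\<close>

lemma first_touching_point:
  fixes f :: "'a::metric_space \<Rightarrow> real \<Rightarrow> real"
  assumes "compact K" and cont: "continuous_on (K \<times> {0..t1}) (\<lambda>(x, t). f x t)"
    and initial: "\<And>x. x \<in> K \<Longrightarrow> f x 0 < 0"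
    and "y \<in> K" and "s \<in> {0..t1}" and "0 \<le> f y s"
  obtains x t where "x \<in> K" and "0 < t" and "t \<le> t1" and "f x t = 0"
    and "\<And>x'. x' \<in> K \<Longrightarrow> f x' t \<le> 0"
    and "\<And>x' t'. x' \<in> K \<Longrightarrow> 0 \<le> t' \<Longrightarrow> t' < t \<Longrightarrow> f x' t' < 0"
proof -
  define P where "P = {p \<in> K \<times> {0..t1}. 0 \<le> (\<lambda>(x, t). f x t) p}"
  have "compact P"
  proof -
    have "closed (K \<times> {0..t1} \<inter> (\<lambda>(x, t). f x t) -` {0..})"
      using continuous_closed_preimage[OF cont] \<open>compact K\<close> by (simp add: closed_Times compact_imp_closed)
    then have "compact (K \<times> {0..t1} \<inter> (K \<times> {0..t1} \<inter> (\<lambda>(x, t). f x t) -` {0..}))"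
      using \<open>compact K\<close> by (intro compact_Int_closed compact_Times) auto
    moreover have "P = K \<times> {0..t1} \<inter> (K \<times> {0..t1} \<inter> (\<lambda>(x, t). f x t) -` {0..})"
      by (auto simp: P_def)
    ultimately show ?thesis by simp
  qed
  have "P \<noteq> {}"
    using assms(4-6) by (auto simp: P_def)
  obtain p where p: "p \<in> P" "\<And>q. q \<in> P \<Longrightarrow> snd p \<le> snd q"
    using continuous_attains_inf[OF \<open>compact P\<close> \<open>P \<noteq> {}\<close> continuous_on_snd[OF continuous_on_id]]
    by blast
  obtain x t where xt: "p = (x, t)" by fastforce
  have x: "x \<in> K" "0 \<le> t" "t \<le> t1" "0 \<le> f x t"
    using p(1) by (auto simp: P_def xt)
  \<comment> \<open>Positivity of \<open>t\<close> leaves room to the left, so continuity in time bounds \<open>f\<close> at time \<open>t\<close> itself.\<close>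
  have "0 < t"
    using x initial[of x] by (cases "t = 0") auto
  have before: "f x' t' < 0" if "x' \<in> K" "0 \<le> t'" "t' < t" for x' t'
    using p(2)[of "(x', t')"] that x by (force simp: P_def xt)
  have at: "f x' t \<le> 0" if "x' \<in> K" for x'
  proof -
    have "continuous_on {0..t} (f x')"
    proof -
      have "continuous_on {0..t} (\<lambda>s. (\<lambda>(x, t). f x t) (x', s))"
        by (rule continuous_on_compose2[OF cont]) (use that x in \<open>auto intro!: continuous_intros\<close>)
      then show ?thesis by simp
    qed
    then have "(f x' \<longlongrightarrow> f x' t) (at t within {0..t})"
      using \<open>0 < t\<close> by (simp add: continuous_on_def)
    then have "(f x' \<longlongrightarrow> f x' t) (at_left t)"
      using \<open>0 < t\<close> by (simp add: at_within_Icc_at_left)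
    moreover have "eventually (\<lambda>s. f x' s \<le> 0) (at_left t)"
      using before[OF that] \<open>0 < t\<close> unfolding eventually_at_left_field
      by (meson less_eq_real_def)
    ultimately show ?thesis
      by (intro tendsto_upperbound[where F = "at_left t"]) auto
  qed
  show thesis
    using that[OF x(1) \<open>0 < t\<close> x(3)] at[OF x(1)] x(4) at before by force
qed

text \<open>
  Both components are compared with the barrier at once, through \<open>max (u - w) (v - w)\<close>: at its first
  zero one component touches \<open>w\<close> while the other is still at most \<open>w\<close>, which bounds the reaction
  term of the touching component by \<open>A e\<^sup>w\<close>.
\<close>

lemma solution_below_barrier:
  fixes u v :: "'a::euclidean_space \<Rightarrow> real \<Rightarrow> real"
  assumes "0 < A" and B: "B = 4 * R\<^sup>2 * (real DIM('a) + 1) + 1"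
    and l: "l1 \<le> A" "l2 \<le> A"
    and sol: "classical_solution l1 l2 R u0 v0 T u v" and "S \<le> T"
    and initial: "\<And>x. x \<in> cball 0 R \<Longrightarrow>
      u x 0 < barrier A B R S x 0 \<and> v x 0 < barrier A B R S x 0"
    and sphere: "\<And>x t. x \<in> sphere 0 R \<Longrightarrow> 0 < t \<Longrightarrow> t < S \<Longrightarrow>
      u x t < barrier A B R S x t \<and> v x t < barrier A B R S x t"
    and y: "y \<in> cball 0 R" and s: "0 \<le> s" "s < S"
  shows "u y s < barrier A B R S y s \<and> v y s < barrier A B R S y s"
proof (rule ccontr)
  assume neg: "\<not> ?thesis"
  define w :: "'a \<Rightarrow> real \<Rightarrow> real" where "w = barrier A B R S"
  define f where "f = (\<lambda>x t. max (u x t - w x t) (v x t - w x t))"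
  have "0 < B" using B by (simp add: add_nonneg_pos)
  note defs = classical_solution_def classical_regularity_def
  have f_cont: "continuous_on (cball 0 R \<times> {0..s}) (\<lambda>(x, t). f x t)"
  proof -
    have "cball 0 R \<times> {0..s} \<subseteq> (cball 0 R :: 'a set) \<times> {0..<T}"
      using s \<open>S \<le> T\<close> by auto
    moreover have "continuous_on (cball 0 R \<times> {0..<T}) (\<lambda>(x, t). u x t)"
        "continuous_on (cball 0 R \<times> {0..<T}) (\<lambda>(x, t). v x t)"
      using sol unfolding defs by blast+
    ultimately have "continuous_on (cball 0 R \<times> {0..s}) (\<lambda>(x, t). u x t)"
        "continuous_on (cball 0 R \<times> {0..s}) (\<lambda>(x, t). v x t)"
      by (meson continuous_on_subset)+
    moreover have "continuous_on (cball 0 R \<times> {0..s}) (\<lambda>(x, t). w x t)"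
      unfolding w_def using continuous_on_barrier[OF \<open>0 < A\<close> \<open>0 < B\<close> s(2)] .
    ultimately show ?thesis
      unfolding f_def case_prod_unfold by (intro continuous_intros)
  qed
  have f_initial: "f x 0 < 0" if "x \<in> cball 0 R" for x
    using initial[OF that] by (simp add: f_def w_def)
  have f_y: "0 \<le> f y s"
    using neg by (auto simp: f_def w_def max_def)
  obtain x t where x: "x \<in> cball 0 R" and t: "0 < t" "t \<le> s" and fx: "f x t = 0"
    and at: "\<And>x'. x' \<in> cball 0 R \<Longrightarrow> f x' t \<le> 0"
    and before: "\<And>x' t'. x' \<in> cball 0 R \<Longrightarrow> 0 \<le> t' \<Longrightarrow> t' < t \<Longrightarrow> f x' t' < 0"
    using first_touching_point[OF compact_cball f_cont f_initial y _ f_y] s by auto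
  have "t < S" "t \<in> {0<..<T}" using t s \<open>S \<le> T\<close> by auto
  have x: "x \<in> ball 0 R"
    using x sphere[of x t] fx t(1) \<open>t < S\<close> by (force simp: f_def w_def max_def split: if_splits)
  have strict: "laplacian (ball 0 R) (\<lambda>y. g y t) x + A * exp (w x t) < deriv (g x) t"
    if "classical_regularity R T g" and "g x t = w x t"
      and "\<And>x t. g x t - w x t \<le> f x t" for g
    unfolding w_def
  proof (rule touching_barrier_strict[OF \<open>0 < A\<close> B x t(1) \<open>t < S\<close>])
    show "Ck_on 2 (ball 0 R) (\<lambda>y. g y t)" "g x differentiable (at t)"
      using that(1) x \<open>t \<in> {0<..<T}\<close> unfolding classical_regularity_def by blast+
    show "g x t = barrier A B R S x t"
      using that(2) by (simp add: w_def)
    show "g y t \<le> barrier A B R S y t" if "y \<in> ball 0 R" for y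
      using at[of y] that \<open>g y t - w y t \<le> f y t\<close> by (simp add: w_def)
    show "g x s < barrier A B R S x s" if "0 \<le> s" "s < t" for s
      using before[of x s] x that \<open>g x s - w x s \<le> f x s\<close> by (simp add: w_def)
  qed
  have reaction: "l * exp r \<le> A * exp (w x t)" if "l \<le> A" "r \<le> w x t" for l r
    using that \<open>0 < A\<close> by (intro mult_mono) auto
  have eqs: "deriv (u x) t = laplacian (ball 0 R) (\<lambda>y. u y t) x + l1 * exp (v x t)"
      "deriv (v x) t = laplacian (ball 0 R) (\<lambda>y. v y t) x + l2 * exp (u x t)"
    using sol x \<open>t \<in> {0<..<T}\<close> unfolding classical_solution_def by blast+
  consider "u x t = w x t" "v x t \<le> w x t" | "v x t = w x t" "u x t \<le> w x t"
    using fx by (auto simp: f_def max_def split: if_splits)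
  then show False
  proof cases
    case 1
    with strict[of u] reaction[OF l(1)] eqs sol show False
      by (fastforce simp: f_def classical_solution_def)
  next
    case 2
    with strict[of v] reaction[OF l(2)] eqs sol show False
      by (fastforce simp: f_def classical_solution_def)
  qed
qed

section \<open>Ordering on the parabolic boundary\<close>

text \<open>
  With \<open>k = 4(d + 1)\<close> one has \<open>k R\<^sup>2 \<le> B\<close>, hence \<open>k (R\<^sup>4 + B T) \<le> B (R\<^sup>2 + k T)\<close>. So the quotient in the
  bound is what makes \<open>A (R\<^sup>4 + B T)\<close>, which exceeds the argument of the logarithm in the barrier at time
  \<open>0\<close>, at most \<open>e\<^sup>-\<^sup>M\<close>.
\<close>

lemma initial_value_below_barrier:
  fixes x :: "'a::euclidean_space"
  assumes "0 < A" and B: "B = 4 * R\<^sup>2 * (d + 1) + 1" and "0 \<le> d"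
    and "0 < S" and "S < T" and x: "norm x \<le> R" and "a \<le> M"
    and bound: "A * B \<le> 4 * (d + 1) / (R\<^sup>2 + 4 * (d + 1) * T) * exp (- M)"
  shows "a < barrier A B R S x 0"
proof -
  define k where "k = 4 * (d + 1)"
  have "0 < k" using \<open>0 \<le> d\<close> by (simp add: k_def)
  have B': "B = k * R\<^sup>2 + 1" by (simp add: B k_def algebra_simps)
  then have "0 < B" using \<open>0 < k\<close> by (simp add: add_nonneg_pos)
  have x2: "0 \<le> R\<^sup>2 - (norm x)\<^sup>2" "R\<^sup>2 - (norm x)\<^sup>2 \<le> R\<^sup>2"
    using x by (auto simp: power_mono)
  have "0 < R\<^sup>2 + k * T"
    using \<open>0 < k\<close> \<open>0 < S\<close> \<open>S < T\<close> by (simp add: add_nonneg_pos)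
  have "k * (A * ((R\<^sup>2 - (norm x)\<^sup>2)\<^sup>2 + B * S)) < k * (A * ((R\<^sup>2)\<^sup>2 + B * T))"
    using x2 \<open>0 < k\<close> \<open>0 < A\<close> \<open>0 < B\<close> \<open>S < T\<close>
    by (intro mult_strict_left_mono add_le_less_mono power_mono) auto
  also have "\<dots> \<le> A * B * (R\<^sup>2 + k * T)"
    using \<open>0 < A\<close> by (simp add: B' algebra_simps power2_eq_square)
  also have "\<dots> \<le> k * exp (- M)"
    using bound \<open>0 < R\<^sup>2 + k * T\<close>
    by (simp only: k_def[symmetric] times_divide_eq_left pos_le_divide_eq)
  finally have "A * ((R\<^sup>2 - (norm x)\<^sup>2)\<^sup>2 + B * S) < exp (- M)"
    using \<open>0 < k\<close> by simp
  moreover have "0 < A * ((R\<^sup>2 - (norm x)\<^sup>2)\<^sup>2 + B * S)"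
    using barrier_argument_pos[OF \<open>0 < B\<close> \<open>0 < S\<close>, of R x] \<open>0 < A\<close> by simp
  ultimately have "ln (A * ((R\<^sup>2 - (norm x)\<^sup>2)\<^sup>2 + B * S)) < - M"
    by (metis ln_exp exp_gt_zero ln_less_cancel_iff)
  then show ?thesis
    using \<open>a \<le> M\<close> by (simp add: barrier_def)
qed

lemma blow_up_rate_below_barrier:
  fixes x :: "'a::euclidean_space"
  assumes "0 < A" and "0 < B" and "0 < C" and bound: "A * B \<le> 1 / C"
    and "t < S" and "S < T" and x: "norm x = R"
  shows "ln C - ln (T - t) < barrier A B R S x t"
proof -
  have "A * (B * (S - t)) < A * (B * (T - t))"
    using assms by simp
  also have "\<dots> \<le> 1 / C * (T - t)"
    using mult_right_mono[OF bound, of "T - t"] assms by simp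
  finally have "A * (B * (S - t)) < (T - t) / C" by simp
  moreover have "0 < A * (B * (S - t))" using assms by simp
  ultimately have "ln (A * (B * (S - t))) < ln ((T - t) / C)"
    by simp
  also have "\<dots> = ln (T - t) - ln C"
    using assms by (simp add: ln_div)
  finally show ?thesis
    using x by (simp add: barrier_def)
qed

text \<open>
  On the sphere the initial condition is not imposed, but the bound extends there from the open ball
  by continuity.
\<close>

lemma initial_value_le_sup_norm:
  fixes f g :: "'a::euclidean_space \<Rightarrow> real"
  assumes "0 < R" and f: "continuous_on (cball 0 R) f"
    and g: "continuous_on (cball 0 R) g"
    and eq: "\<And>y. y \<in> ball 0 R \<Longrightarrow> f y = g y" and x: "x \<in> cball 0 R"
  shows "f x \<le> sup_norm (ball 0 R) g"
proof -
  have "bounded (g ` cball 0 R)"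
    by (intro compact_imp_bounded compact_continuous_image g compact_cball)
  then obtain K where K: "\<And>y. y \<in> cball 0 R \<Longrightarrow> \<bar>g y\<bar> \<le> K"
    unfolding bounded_iff by (metis imageI real_norm_def)
  have "bdd_above ((\<lambda>y. \<bar>g y\<bar>) ` ball 0 R)"
    by (rule bdd_aboveI[of _ K]) (use K in auto)
  then have "\<bar>g y\<bar> \<le> sup_norm (ball 0 R) g" if "y \<in> ball 0 R" for y
    unfolding sup_norm_def using that by (rule cSUP_upper2[OF _ _ order_refl])
  then have "f y \<le> sup_norm (ball 0 R) g" if "y \<in> ball 0 R" for y
    using that eq[OF that] abs_ge_self[of "g y"] by fastforce
  moreover have "closure (ball 0 R) = (cball 0 R :: 'a set)"
    using \<open>0 < R\<close> by simp
  ultimately show ?thesis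
    using f x continuous_le_on_closure[of "ball 0 R" f x] by simp
qed

section \<open>The upper bound inside the ball\<close>

theorem theorem4p1:
  fixes u v :: "real ^ 'n \<Rightarrow> real \<Rightarrow> real"
    and u0 v0 :: "real ^ 'n \<Rightarrow> real"
    and R T C lam1 lam2 lam :: real
    and n :: nat
  assumes "0 < R"
    and "0 < lam1" and "0 < lam2" and "lam = max lam1 lam2"
    and "n = CARD('n)"
    and "admissible_data R u0 v0"
    and "blow_up_solution lam1 lam2 R u0 v0 T u v"
    and "0 < C"
    and "\<forall>x\<in>sphere 0 R. \<forall>t\<in>{0<..<T}. u x t \<le> ln C - ln (T - t)"
    and "\<forall>x\<in>sphere 0 R. \<forall>t\<in>{0<..<T}. v x t \<le> ln C - ln (T - t)"
    and "lam * (4 * R\<^sup>2 * (real n + 1) + 1) \<le>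
      Min {1 / C,
           4 * (real n + 1) / (R\<^sup>2 + 4 * (real n + 1) * T) * exp (- sup_norm (ball 0 R) u0),
           4 * (real n + 1) / (R\<^sup>2 + 4 * (real n + 1) * T) * exp (- sup_norm (ball 0 R) v0)}"
  shows "\<exists>A>0. \<forall>x\<in>ball 0 R. \<forall>t\<in>{0<..<T}.
    u x t \<le> ln (1 / (A * (R\<^sup>2 - (norm x)\<^sup>2)\<^sup>2)) \<and>
    v x t \<le> ln (1 / (A * (R\<^sup>2 - (norm x)\<^sup>2)\<^sup>2))"
proof -
  define B where "B = 4 * R\<^sup>2 * (real n + 1) + 1"
  have n: "n = DIM(real ^ 'n)" by (simp add: \<open>n = CARD('n)\<close>)
  have "0 < lam" "lam1 \<le> lam" "lam2 \<le> lam" using assms(2-4) by auto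
  have "0 < B" by (simp add: B_def add_nonneg_pos)
  have bounds: "lam * B \<le> 1 / C"
      "lam * B \<le> 4 * (real n + 1) / (R\<^sup>2 + 4 * (real n + 1) * T) * exp (- sup_norm (ball 0 R) u0)"
      "lam * B \<le> 4 * (real n + 1) / (R\<^sup>2 + 4 * (real n + 1) * T) * exp (- sup_norm (ball 0 R) v0)"
    using assms(11) unfolding B_def by simp_all
  have "0 < T" and sol: "classical_solution lam1 lam2 R u0 v0 T u v"
    using assms(7) by (auto simp: blow_up_solution_def)
  have initial: "u x 0 \<le> sup_norm (ball 0 R) u0" "v x 0 \<le> sup_norm (ball 0 R) v0"
    if x: "x \<in> cball 0 R" for x
  proof -
    have cont0: "continuous_on (cball 0 R) (\<lambda>x. g x 0)"
      if "classical_regularity R T g" for g :: "real ^ 'n \<Rightarrow> real \<Rightarrow> real"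
    proof -
      have cont: "continuous_on (cball 0 R \<times> {0..<T}) (\<lambda>(x, t). g x t)"
        using that unfolding classical_regularity_def by blast
      have "continuous_on (cball 0 R) (\<lambda>x. (\<lambda>(x, t). g x t) (x, 0))"
        by (rule continuous_on_compose2[OF cont])
          (use \<open>0 < T\<close> in \<open>auto intro!: continuous_intros\<close>)
      then show ?thesis by simp
    qed
    have cont: "continuous_on (cball 0 R) u0" "continuous_on (cball 0 R) v0"
      using assms(6) unfolding admissible_data_def smooth_on_def by (metis Ck_on.simps(1))+
    show "u x 0 \<le> sup_norm (ball 0 R) u0"
      by (rule initial_value_le_sup_norm[OF \<open>0 < R\<close> cont0 cont(1) _ x])
        (use sol in \<open>auto simp: classical_solution_def\<close>)
    show "v x 0 \<le> sup_norm (ball 0 R) v0"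
      by (rule initial_value_le_sup_norm[OF \<open>0 < R\<close> cont0 cont(2) _ x])
        (use sol in \<open>auto simp: classical_solution_def\<close>)
  qed
  have "u x t \<le> ln (1 / (lam * (R\<^sup>2 - (norm x)\<^sup>2)\<^sup>2)) \<and>
      v x t \<le> ln (1 / (lam * (R\<^sup>2 - (norm x)\<^sup>2)\<^sup>2))"
    if x: "x \<in> ball 0 R" and t: "t \<in> {0<..<T}" for x t
  proof -
    define S where "S = (t + T) / 2"
    have S: "t < S" "S < T" "0 < S" using t by (auto simp: S_def field_simps)
    have "u x t < barrier lam B R S x t \<and> v x t < barrier lam B R S x t"
    proof (rule solution_below_barrier[OF \<open>0 < lam\<close> _ \<open>lam1 \<le> lam\<close> \<open>lam2 \<le> lam\<close> sol])
      show "B = 4 * R\<^sup>2 * (real DIM(real ^ 'n) + 1) + 1" by (simp add: B_def n)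
      show "u y 0 < barrier lam B R S y 0 \<and> v y 0 < barrier lam B R S y 0"
        if "y \<in> cball 0 R" for y
        using initial_value_below_barrier[OF \<open>0 < lam\<close> B_def _ S(3,2) _ initial(1)[OF that] bounds(2), of y]
          initial_value_below_barrier[OF \<open>0 < lam\<close> B_def _ S(3,2) _ initial(2)[OF that] bounds(3), of y] that
        by simp
      show "u y s < barrier lam B R S y s \<and> v y s < barrier lam B R S y s"
        if "y \<in> sphere 0 R" "0 < s" "s < S" for y s
      proof -
        have "s \<in> {0<..<T}" using that S by simp
        then have "u y s \<le> ln C - ln (T - s)" "v y s \<le> ln C - ln (T - s)"
          using assms(9,10) that(1) by blast+
        moreover have "ln C - ln (T - s) < barrier lam B R S y s"
          using that(1) by (intro blow_up_rate_below_barrier \<open>0 < lam\<close> \<open>0 < B\<close> \<open>0 < C\<close>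
            bounds(1) that(3) S(2)) simp
        ultimately show ?thesis by simp
      qed
    qed (use x t S in auto)
    moreover have "barrier lam B R S x t \<le> ln (1 / (lam * (R\<^sup>2 - (norm x)\<^sup>2)\<^sup>2))"
    proof -
      have "(norm x)\<^sup>2 < R\<^sup>2" using x by (simp add: power_strict_mono)
      then have pos: "0 < lam * (R\<^sup>2 - (norm x)\<^sup>2)\<^sup>2" using \<open>0 < lam\<close> by simp
      have "lam * (R\<^sup>2 - (norm x)\<^sup>2)\<^sup>2 \<le> lam * ((R\<^sup>2 - (norm x)\<^sup>2)\<^sup>2 + B * (S - t))"
        using \<open>0 < lam\<close> \<open>0 < B\<close> S by simp
      with pos have "ln (lam * (R\<^sup>2 - (norm x)\<^sup>2)\<^sup>2) \<le>
          ln (lam * ((R\<^sup>2 - (norm x)\<^sup>2)\<^sup>2 + B * (S - t)))"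
        by (intro ln_mono) auto
      moreover have "ln (1 / X) = - ln X" for X :: real
        by (metis inverse_eq_divide ln_inverse)
      ultimately show ?thesis by (simp only: barrier_def neg_le_iff_le)
    qed
    ultimately show ?thesis by simp
  qed
  then show ?thesis using \<open>0 < lam\<close> by blast
qed

end
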